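(* (Mehler summation formula.) Let $r>0$, $\sigma^2>0$, $\Omega\in\mathbb{R}$, $\rho=\frac{2\sigma^2}{r}$, $c=\frac{\Omega}{r}$ and $u\in(0,1)$. Then for $x,y\in\mathbb{R}^2$, $$\sum_{m=0}^\infty\sum_{n=0}^{\infty}\frac{u^{m+n+\mathrm{i}(m-n)c}}{m!\,n!\,\rho^{m+n}}J_{m,n}(x)\overline{J_{m,n}(y)}=\frac{1}{1-u^2}\exp\Big\{-\frac{u^2|y|^2+u^2|x|^2-2u(\tilde B_0(u)x,y)}{\rho(1-u^2)}\Big\},$$ where the sum converges pointwise and in $L^2_{\mathbb{C}}(\mu)\otimes L^2_{\mathbb{C}}(\mu)$.
   Context: $\mathrm{i}=\sqrt{-1}$; $(x,y)=x'y$ is the Euclidean inner product on $\mathbb{R}^2$ and $|x|$ the Euclidean norm. The measure $\mu$ on $\mathbb{R}^2$ is $\mathrm{d}\mu=\frac{1}{\pi\rho}e^{-|x|^2/\rho}\,\mathrm{d}x$ (with $\mathrm{d}x$ Lebesgue measure on $\mathbb{R}^2$), and $L^2_{\mathbb{C}}(\mu)$ is the space of complex-valued square-integrable functions. For $t\ge 0$ let $B_0(t)=\begin{bmatrix}\cos\Omega t&\sin\Omega t\\-\sin\Omega t&\cos\Omega t\end{bmatrix}$, and set $\tilde B_0(u)=B_0(-\frac1r\log u)$. With $\frac{\partial}{\partial z}=\frac12(\frac{\partial}{\partial x_1}-\mathrm{i}\frac{\partial}{\partial x_2})$ and $\frac{\partial}{\partial\bar z}=\frac12(\frac{\partial}{\partial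 x_1}+\mathrm{i}\frac{\partial}{\partial x_2})$ for $z=x_1+\mathrm{i}x_2$, define $(\partial^*\phi)(z)=-\frac{\partial}{\partial\bar z}\phi(z)+\frac{z}{\rho}\phi(z)$ and $(\bar\partial^*\phi)(z)=-\frac{\partial}{\partial z}\phi(z)+\frac{\bar z}{\rho}\phi(z)$. The Hermite-Laguerre-Ito polynomials are $J_{0,0}(z,\rho)=1$, $J_{m,n}(z,\rho)=\rho^{m+n}(\partial^* )^m(\bar\partial^* )^n1$ for integers $m,n\ge0$. For $x=(x_1,x_2)\in\mathbb{R}^2$, $J_{m,n}(x)$ means $J_{m,n}(x_1+\mathrm{i}x_2,\rho)$. *)

theory Defs
  imports "HOL-Analysis.Analysis"
begin

definition gauss_measure :: "real \<Rightarrow> (real^2) measure" where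
  "gauss_measure \<rho> =
     density lborel (\<lambda>x. ennreal (1 / (pi * \<rho>) * exp (- (norm x)\<^sup>2 / \<rho>)))"

definition rot_B0 :: "real \<Rightarrow> real \<Rightarrow> real^2^2" where
  "rot_B0 \<Omega> t = vector [vector [cos (\<Omega> * t), sin (\<Omega> * t)],
                       vector [- sin (\<Omega> * t), cos (\<Omega> * t)]]"

definition rot_Btilde0 :: "real \<Rightarrow> real \<Rightarrow> real \<Rightarrow> real^2^2" where
  "rot_Btilde0 \<Omega> r u = rot_B0 \<Omega> (- (1 / r) * ln u)"

text \<open>Partial derivatives in the two real coordinates \<open>z = x\<^sub>1 + \<i> x\<^sub>2\<close>. The library constant
  \<open>vector_derivative\<close> is total and is meaningful only where the derivative exists, as it does
  for the polynomials in \<open>z\<close> and \<open>cnj z\<close> to which it is applied below.\<close>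

definition partial_1 :: "(complex \<Rightarrow> complex) \<Rightarrow> complex \<Rightarrow> complex" where
  "partial_1 \<phi> z = vector_derivative (\<lambda>t. \<phi> (Complex t (Im z))) (at (Re z))"

definition partial_2 :: "(complex \<Rightarrow> complex) \<Rightarrow> complex \<Rightarrow> complex" where
  "partial_2 \<phi> z = vector_derivative (\<lambda>t. \<phi> (Complex (Re z) t)) (at (Im z))"

definition d_z :: "(complex \<Rightarrow> complex) \<Rightarrow> complex \<Rightarrow> complex" where
  "d_z \<phi> z = (1 / 2) * (partial_1 \<phi> z - \<i> * partial_2 \<phi> z)"

definition d_zbar :: "(complex \<Rightarrow> complex) \<Rightarrow> complex \<Rightarrow> complex" where
  "d_zbar \<phi> z = (1 / 2) * (partial_1 \<phi> z + \<i> * partial_2 \<phi> z)"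

definition d_star :: "real \<Rightarrow> (complex \<Rightarrow> complex) \<Rightarrow> complex \<Rightarrow> complex" where
  "d_star \<rho> \<phi> z = - d_zbar \<phi> z + z / of_real \<rho> * \<phi> z"

definition dbar_star :: "real \<Rightarrow> (complex \<Rightarrow> complex) \<Rightarrow> complex \<Rightarrow> complex" where
  "dbar_star \<rho> \<phi> z = - d_z \<phi> z + cnj z / of_real \<rho> * \<phi> z"

definition hermite_laguerre_ito :: "nat \<Rightarrow> nat \<Rightarrow> complex \<Rightarrow> real \<Rightarrow> complex" where
  "hermite_laguerre_ito m n z \<rho> =
     of_real (\<rho> ^ (m + n)) * ((d_star \<rho> ^^ m) ((dbar_star \<rho> ^^ n) (\<lambda>_. 1))) z"

definition hermite_laguerre_ito_R2 :: "real \<Rightarrow> nat \<Rightarrow> nat \<Rightarrow> real^2 \<Rightarrow> complex" where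
  "hermite_laguerre_ito_R2 \<rho> m n x = hermite_laguerre_ito m n (Complex (x $ 1) (x $ 2)) \<rho>"

definition mehler_term ::
  "real \<Rightarrow> real \<Rightarrow> real \<Rightarrow> nat \<Rightarrow> nat \<Rightarrow> real^2 \<Rightarrow> real^2 \<Rightarrow> complex" where
  "mehler_term \<rho> c u m n x y =
     of_real u powr (of_nat (m + n) + \<i> * (of_nat m - of_nat n) * of_real c)
       / (fact m * fact n * of_real (\<rho> ^ (m + n)))
       * hermite_laguerre_ito_R2 \<rho> m n x * cnj (hermite_laguerre_ito_R2 \<rho> m n y)"

definition mehler_kernel :: "real \<Rightarrow> real \<Rightarrow> real \<Rightarrow> real \<Rightarrow> real^2 \<Rightarrow> real^2 \<Rightarrow> real" where
  "mehler_kernel \<rho> \<Omega> r u x y =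
     1 / (1 - u\<^sup>2) *
       exp (- (u\<^sup>2 * (norm y)\<^sup>2 + u\<^sup>2 * (norm x)\<^sup>2 - 2 * u * ((rot_Btilde0 \<Omega> r u *v x) \<bullet> y))
              / (\<rho> * (1 - u\<^sup>2)))"

definition square_integrable :: "'a measure \<Rightarrow> ('a \<Rightarrow> complex) \<Rightarrow> bool" where
  "square_integrable M f \<longleftrightarrow>
     f \<in> borel_measurable M \<and> integrable M (\<lambda>x. (cmod (f x))\<^sup>2)"

definition L2_norm :: "'a measure \<Rightarrow> ('a \<Rightarrow> complex) \<Rightarrow> real" where
  "L2_norm M f = sqrt (LINT x|M. (cmod (f x))\<^sup>2)"

text \<open>Unordered summation in \<open>L\<^sup>2(M)\<close>: the analogue of \<^const>\<open>has_sum\<close> for the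
  \<open>L\<^sup>2\<close>-norm. The membership conditions are required because the Bochner integral of a
  non-integrable function is \<open>0\<close>.\<close>

definition has_L2_sum ::
  "'a measure \<Rightarrow> ('i \<Rightarrow> 'a \<Rightarrow> complex) \<Rightarrow> ('a \<Rightarrow> complex) \<Rightarrow> 'i set \<Rightarrow> bool" where
  "has_L2_sum M f g I \<longleftrightarrow>
     (\<forall>i\<in>I. square_integrable M (f i)) \<and> square_integrable M g \<and>
     ((\<lambda>F. L2_norm M (\<lambda>x. (\<Sum>i\<in>F. f i x) - g x)) \<longlongrightarrow> 0) (finite_subsets_at_top I)"

end

theory Submission
  imports Defs "HOL-Probability.Distributions"
begin

text \<open>
  The polynomials satisfy \<open>J\<^bsub>m+1,n\<^esub> = z J\<^bsub>m,n\<^esub> - \<rho> n J\<^bsub>m,n-1\<^esub>\<close> and have an explicit form with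
  generating function \<open>exp (s z + t cnj z - \<rho> s t)\<close>. Multiplication by \<open>z\<close> in the recursion shows
  that the generating function of the shifted family \<open>J\<^bsub>i+l,j+l\<^esub>\<close> is the same exponential times
  \<open>J\<^bsub>l,l\<^esub>\<close> at the independent arguments \<open>z - \<rho> t\<close>, \<open>cnj z - \<rho> s\<close>. Expanding one of the two factors of the Mehler
  sum therefore reduces it to the generating function of the diagonal (Laguerre) polynomials
  \<open>J\<^bsub>l,l\<^esub>\<close>. All rearrangements are justified by the same identities with \<open>\<rho>\<close> replaced by \<open>- \<bar>\<rho>\<bar>\<close>
  and the arguments by their norms, where every term is nonnegative.

  For mean-square convergence no orthogonality is needed. By the pointwise formula at
  \<open>x = y\<close>, \<open>\<Omega> = 0\<close>, the nonnegative functions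
  \<open>A\<^bsub>m,n\<^esub>(x) = u\<^bsup>m+n\<^esup> |J\<^bsub>m,n\<^esub>(x)|\<^sup>2 / (m! n! \<rho>\<^bsup>m+n\<^esup>)\<close> sum to a constant times
  \<open>exp (2 u |x|\<^sup>2 / (\<rho> (1 + u)))\<close>, which is integrable against the Gaussian since \<open>2 u / (1 + u) < 1\<close>.
  If \<open>R\<^sub>F\<close> is the remainder of this sum after the finite set \<open>F\<close> of indices, Cauchy-Schwarz bounds the
  squared remainder of the Mehler sum at \<open>(x, y)\<close> by \<open>R\<^sub>F(x) R\<^sub>F(y)\<close>, so its \<open>L\<^sup>2\<close>-norm is at
  most the integral of \<open>R\<^sub>F\<close>, which tends to 0 by dominated convergence.
\<close>

subsection \<open>Unordered sums\<close>

text \<open>Fubini for unordered sums: iterated summation of the nonnegative majorant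
  \<open>F\<close> gives absolute summability on the product, after which \<open>f\<close> may be
  summed one index at a time.\<close>

lemma has_sum_Times_dominated:
  fixes f :: "'a \<times> 'b \<Rightarrow> 'c :: banach" and F :: "'a \<times> 'b \<Rightarrow> real"
  assumes f: "\<And>x. ((\<lambda>y. f (x, y)) has_sum g x) UNIV" and g: "(g has_sum S) UNIV"
    and F: "\<And>x. ((\<lambda>y. F (x, y)) has_sum G x) UNIV" and G: "G summable_on UNIV"
    and le: "\<And>z. norm (f z) \<le> F z"
  shows "(f has_sum S) UNIV"
proof -
  have "F summable_on (UNIV \<times> UNIV)"
    using F G order_trans[OF norm_ge_zero le] by (intro summable_on_SigmaI) auto
  then have "(\<lambda>z. norm (f z)) summable_on (UNIV \<times> UNIV)"
    using le by (rule Infinite_Sum.abs_summable_on_comparison_test')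
  then have "f summable_on (UNIV \<times> UNIV)"
    by (rule abs_summable_summable)
  then have "(f has_sum S) (UNIV \<times> UNIV)"
    using f g by (intro has_sum_SigmaI) auto
  then show ?thesis by simp
qed

lemma has_sum_exp:
  fixes x :: "'a :: {real_normed_field, banach}"
  shows "((\<lambda>n. x ^ n / fact n) has_sum exp x) UNIV"
proof (rule norm_summable_imp_has_sum)
  show "summable (\<lambda>n. norm (x ^ n / fact n))"
    using summable_norm_exp[of x] by (simp add: field_simps norm_divide norm_mult)
  show "(\<lambda>n. x ^ n / fact n) sums exp x"
    using exp_converges[of x] by (simp add: field_simps scaleR_conv_of_real)
qed

lemma has_sum_exp_triple:
  fixes a b c :: "'a :: {real_normed_field, banach}"
  shows "((\<lambda>(k, i, j). a ^ k / fact k * (b ^ i / fact i * (c ^ j / fact j)))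
            has_sum (exp a * (exp b * exp c))) UNIV"
proof -
  \<comment> \<open>Polymorphic, since it is applied at \<open>b\<close>, \<open>c\<close> and again
    over the reals at their norms for the majorant.\<close>
  have two: "((\<lambda>(i, j). b ^ i / fact i * (c ^ j / fact j)) has_sum (exp b * exp c)) UNIV"
    for b c :: "'b :: {real_normed_field, banach}"
    by (rule has_sum_Times_dominated[where g = "\<lambda>i. b ^ i / fact i * exp c"
          and F = "\<lambda>(i, j). norm b ^ i / fact i * (norm c ^ j / fact j)"
          and G = "\<lambda>i. norm b ^ i / fact i * exp (norm c)"])
       (auto intro!: has_sum_cmult_right has_sum_cmult_left has_sum_exp
          has_sum_imp_summable[OF has_sum_cmult_left] simp: norm_mult norm_divide norm_power
          simp del: times_divide_eq_left times_divide_eq_right times_divide_times_eq)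
  show ?thesis
    using two[of b c] two[of "norm b" "norm c"]
    by (intro has_sum_Times_dominated[where g = "\<lambda>k. a ^ k / fact k * (exp b * exp c)"
          and F = "\<lambda>(k, i, j). norm a ^ k / fact k * (norm b ^ i / fact i * (norm c ^ j / fact j))"
          and G = "\<lambda>k. norm a ^ k / fact k * (exp (norm b) * exp (norm c))"])
       (auto intro!: has_sum_cmult_right has_sum_cmult_left has_sum_exp
          has_sum_imp_summable[OF has_sum_cmult_left]
          simp: norm_mult norm_divide norm_power case_prod_unfold
          simp del: times_divide_eq_left times_divide_eq_right times_divide_times_eq)
qed

text \<open>Grouping by \<open>m = i + l\<close>, \<open>n = j + l\<close>: the fibre over
  \<open>(m, n)\<close> is the finite set \<open>l \<le> min m n\<close>.\<close>

lemma has_sum_diagonal: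
  fixes f :: "nat \<Rightarrow> nat \<Rightarrow> nat \<Rightarrow> 'a :: banach"
  assumes "((\<lambda>(l, i, j). f l i j) has_sum S) UNIV"
  shows "((\<lambda>(m, n). \<Sum>l\<le>min m n. f l (m - l) (n - l)) has_sum S) UNIV"
proof -
  have "((\<lambda>((m, n), l). f l (m - l) (n - l)) has_sum S) (SIGMA (m, n):UNIV. {..min m n})"
    using assms
    by (subst has_sum_reindex_bij_witness[where T = UNIV and h = "\<lambda>(l, i, j). f l i j"
          and i = "\<lambda>(l, i, j). ((i + l, j + l), l)" and j = "\<lambda>((m, n), l). (l, m - l, n - l)"])
       auto
  then show ?thesis
    by (rule has_sum_SigmaD) (auto intro!: has_sum_finiteI)
qed

lemma has_sum_antidiagonal:
  fixes f :: "nat \<Rightarrow> nat \<Rightarrow> 'a :: banach"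
  assumes "((\<lambda>(j, k). f j k) has_sum S) UNIV"
  shows "((\<lambda>l. \<Sum>k\<le>l. f (l - k) k) has_sum S) UNIV"
proof -
  have "((\<lambda>(l, k). f (l - k) k) has_sum S) (SIGMA l:UNIV. {..l})"
    using assms
    by (subst has_sum_reindex_bij_witness[where T = UNIV and h = "\<lambda>(j, k). f j k"
          and i = "\<lambda>(j, k). (j + k, k)" and j = "\<lambda>(l, k). (l - k, k)"]) auto
  then show ?thesis
    by (rule has_sum_SigmaD) (auto intro!: has_sum_finiteI)
qed

text \<open>Induction on \<open>j\<close>: each Cauchy product with the geometric series raises the
  exponent by one, and the hockey-stick identity evaluates the new coefficients.\<close>

lemma has_sum_negative_binomial:
  fixes y :: "'a :: {real_normed_field, banach}"
  assumes "norm y < 1"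
  shows "((\<lambda>k. of_nat (j + k choose k) * y ^ k) has_sum (1 / (1 - y)) ^ Suc j) UNIV"
proof -
  have pascal: "(\<Sum>i\<le>k. of_nat (j + i choose i) * y ^ i * y ^ (k - i))
      = of_nat (Suc j + k choose k) * y ^ k" for j k and y :: "'b :: {real_normed_field, banach}"
  proof -
    have "(\<Sum>i\<le>k. of_nat (j + i choose i) * y ^ i * y ^ (k - i))
        = of_nat (\<Sum>i\<le>k. j + i choose i) * y ^ k"
      unfolding of_nat_sum sum_distrib_right
      by (intro sum.cong refl) (simp add: mult.assoc flip: power_add)
    then show ?thesis
      by (simp only: sum_choose_lower) simp
  qed
  have summable: "summable (\<lambda>k. norm (of_nat (j + k choose k) * y ^ k))" for j
  proof (induction j)
    case 0
    show ?case using assms by (simp add: norm_power summable_geometric)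
  next
    case (Suc j)
    have "summable (\<lambda>k. \<Sum>i\<le>k. norm (of_nat (j + i choose i) * y ^ i) * norm (y ^ (k - i)))"
      using assms Suc by (intro summable_Cauchy_product) (auto simp: norm_power summable_geometric)
    then show ?case
      using pascal[of j "norm y"] by (simp add: norm_mult norm_power)
  qed
  have "(\<lambda>k. of_nat (j + k choose k) * y ^ k) sums (1 / (1 - y)) ^ Suc j" for j
  proof (induction j)
    case 0
    show ?case using geometric_sums[OF assms] by simp
  next
    case (Suc j)
    have "(\<lambda>k. \<Sum>i\<le>k. (of_nat (j + i choose i) * y ^ i) * y ^ (k - i)) sums
       ((\<Sum>k. of_nat (j + k choose k) * y ^ k) * (\<Sum>k. y ^ k))"
      using summable[of j] assms
      by (intro Cauchy_product_sums) (auto simp: norm_power summable_geometric)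
    also have "(\<Sum>k. of_nat (j + k choose k) * y ^ k) * (\<Sum>k. y ^ k) = (1 / (1 - y)) ^ Suc (Suc j)"
      using Suc geometric_sums[OF assms] by (simp add: sums_iff)
    finally show ?case by (simp only: pascal)
  qed
  with summable[of j] show ?thesis by (intro norm_summable_imp_has_sum)
qed

subsection \<open>Ito polynomials and their generating functions\<close>

text \<open>\<open>Z\<close> and \<open>W\<close> stand for \<open>z\<close> and its conjugate. Keeping them independent, over a general field,
  lets the same identities serve over the reals, where \<open>\<rho> < 0 \<le> Z, W\<close> makes all coefficients
  nonnegative and yields majorants.\<close>

definition ito_poly :: "'a :: field_char_0 \<Rightarrow> 'a \<Rightarrow> 'a \<Rightarrow> nat \<Rightarrow> nat \<Rightarrow> 'a" where
  "ito_poly \<rho> Z W m n =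
     (\<Sum>k\<le>n. fact k * of_nat (m choose k) * of_nat (n choose k) * (- \<rho>) ^ k * Z ^ (m - k) * W ^ (n - k))"

text \<open>Cancelling factorials exhibits a coefficient of a product of three exponential series;
  this form is also symmetric under exchanging the two index-argument pairs.\<close>

lemma ito_poly_conv_fact:
  "ito_poly \<rho> Z W m n =
     fact m * fact n * (\<Sum>k\<le>min m n. (- \<rho>) ^ k / fact k * (Z ^ (m - k) / fact (m - k)) * (W ^ (n - k) / fact (n - k)))"
proof -
  have "ito_poly \<rho> Z W m n =
     (\<Sum>k\<le>min m n. fact k * of_nat (m choose k) * of_nat (n choose k) * (- \<rho>) ^ k * Z ^ (m - k) * W ^ (n - k))"
    unfolding ito_poly_def by (rule sum.mono_neutral_right) auto
  also have "\<dots> = fact m * fact n * (\<Sum>k\<le>min m n. (- \<rho>) ^ k / fact k * (Z ^ (m - k) / fact (m - k)) * (W ^ (n - k) / fact (n - k)))"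
    unfolding sum_distrib_left
    by (intro sum.cong refl) (simp add: binomial_fact field_simps)
  finally show ?thesis .
qed

lemma ito_poly_commute: "ito_poly \<rho> Z W m n = ito_poly \<rho> W Z n m"
  unfolding ito_poly_conv_fact by (simp add: min.commute mult_ac)

lemma ito_poly_0_left [simp]: "ito_poly \<rho> Z W 0 n = W ^ n"
  unfolding ito_poly_conv_fact by simp

lemma ito_poly_0_right [simp]: "ito_poly \<rho> Z W m 0 = Z ^ m"
  unfolding ito_poly_conv_fact by simp

text \<open>Pascal's rule on \<open>Suc m choose k\<close> produces the first term plus a remainder
  that absorption turns into the second. At \<open>n = 0\<close> the truncated \<open>n - 1\<close>
  is harmless, its factor being zero.\<close>

lemma ito_poly_Suc_left:
  "ito_poly \<rho> Z W (Suc m) n = Z * ito_poly \<rho> Z W m n - \<rho> * of_nat n * ito_poly \<rho> Z W m (n - 1)"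
proof (cases n)
  case 0
  then show ?thesis by (simp add: ito_poly_def)
next
  case (Suc n')
  let ?a = "\<lambda>m k. fact k * of_nat (m choose k) * of_nat (n choose k) * (- \<rho>) ^ k * Z ^ (m - k) * W ^ (n - k)"
  let ?b = "\<lambda>k. fact k * of_nat (m choose (k - 1)) * of_nat (n choose k) * (- \<rho>) ^ k * Z ^ (Suc m - k) * W ^ (n - k)"
  have split: "?a (Suc m) (Suc k) = Z * ?a m (Suc k) + ?b (Suc k)" for k
  proof (cases "Suc k \<le> m")
    case True
    then have "Z ^ (m - k) = Z * Z ^ (m - Suc k)"
      by (metis Suc_diff_Suc less_eq_Suc_le power_Suc)
    then show ?thesis by (simp add: algebra_simps)
  qed (simp add: binomial_eq_0)
  have shift: "?b (Suc k) = - \<rho> * of_nat n * (fact k * of_nat (m choose k) * of_nat (n' choose k) * (- \<rho>) ^ k * Z ^ (m - k) * W ^ (n' - k))" for k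
  proof -
    have "of_nat (Suc k) * of_nat (n choose Suc k) = (of_nat n * of_nat (n' choose k) :: 'a)"
      unfolding Suc of_nat_mult[symmetric] by (rule arg_cong[OF Suc_times_binomial])
    then have "(fact (Suc k) * of_nat (n choose Suc k) :: 'a) = of_nat n * (fact k * of_nat (n' choose k))"
      by (simp only: fact_Suc mult_ac)
    then show ?thesis unfolding Suc by (simp add: mult_ac del: fact_Suc)
  qed
  have "ito_poly \<rho> Z W (Suc m) n = ?a (Suc m) 0 + (\<Sum>k\<le>n'. ?a (Suc m) (Suc k))"
    unfolding ito_poly_def Suc by (rule sum.atMost_Suc_shift)
  also have "\<dots> = Z * (?a m 0 + (\<Sum>k\<le>n'. ?a m (Suc k))) + (\<Sum>k\<le>n'. ?b (Suc k))"
    by (simp only: split sum.distrib sum_distrib_left distrib_left) simp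
  also have "?a m 0 + (\<Sum>k\<le>n'. ?a m (Suc k)) = ito_poly \<rho> Z W m n"
    unfolding ito_poly_def Suc by (rule sum.atMost_Suc_shift[symmetric])
  also have "(\<Sum>k\<le>n'. ?b (Suc k)) = - \<rho> * of_nat n * ito_poly \<rho> Z W m n'"
    unfolding shift ito_poly_def sum_distrib_left ..
  finally show ?thesis using Suc by simp
qed

lemma norm_ito_poly_le:
  fixes \<rho> :: "'a :: real_normed_field"
  shows "norm (ito_poly \<rho> Z W m n) \<le> ito_poly (- norm \<rho>) (norm Z) (norm W) m n"
  unfolding ito_poly_def
  by (rule order_trans[OF norm_sum]) (simp add: norm_mult norm_power)

text \<open>The exponential factors as \<open>exp (- \<rho> * s * t)\<close> times
  \<open>exp (s * Z)\<close> times \<open>exp (t * W)\<close>; collecting equal powers of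
  \<open>s\<close> and \<open>t\<close> gives the polynomials.\<close>

lemma ito_poly_generating_function:
  fixes \<rho> :: "'a :: {real_normed_field, banach}"
  shows "((\<lambda>(i, j). s ^ i / fact i * (t ^ j / fact j) * ito_poly \<rho> Z W i j)
            has_sum exp (s * Z + t * W - \<rho> * s * t)) UNIV"
proof -
  have "(\<Sum>k\<le>min i j. (- \<rho> * s * t) ^ k / fact k * ((s * Z) ^ (i - k) / fact (i - k) * ((t * W) ^ (j - k) / fact (j - k))))
     = s ^ i / fact i * (t ^ j / fact j) * ito_poly \<rho> Z W i j" for i j
    unfolding ito_poly_conv_fact sum_distrib_left
  proof (intro sum.cong refl)
    fix k assume "k \<in> {..min i j}"
    then have st: "s ^ i = s ^ k * s ^ (i - k)" "t ^ j = t ^ k * t ^ (j - k)"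
      by (simp_all flip: power_add)
    then show "(- \<rho> * s * t) ^ k / fact k * ((s * Z) ^ (i - k) / fact (i - k) * ((t * W) ^ (j - k) / fact (j - k)))
      = s ^ i / fact i * (t ^ j / fact j) * (fact i * fact j * ((- \<rho>) ^ k / fact k * (Z ^ (i - k) / fact (i - k)) * (W ^ (j - k) / fact (j - k))))"
      by (simp only: st power_mult_distrib) (simp add: field_simps)
  qed
  moreover have "exp (- \<rho> * s * t) * (exp (s * Z) * exp (t * W)) = exp (s * Z + t * W - \<rho> * s * t)"
    by (simp add: mult_exp_exp algebra_simps)
  ultimately show ?thesis
    using has_sum_diagonal[OF has_sum_exp_triple[of "- \<rho> * s * t" "s * Z" "t * W"]] by simp
qed

text \<open>Term \<open>j\<close> of \<open>t\<close> times a series comes from term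
  \<open>j - 1\<close>; the default 0 at \<open>j = 0\<close> keeps all pairs as the index
  set.\<close>

lemma has_sum_shift_snd:
  fixes f :: "nat \<times> nat \<Rightarrow> 'a :: banach"
  assumes "(f has_sum S) UNIV"
  shows "((\<lambda>(i, j). if j = 0 then 0 else f (i, j - 1)) has_sum S) UNIV"
proof -
  have "((\<lambda>(i, j). f (i, j - 1)) has_sum S) (UNIV \<times> {0<..})"
    using assms
    by (subst has_sum_reindex_bij_witness[where T = UNIV and h = f
          and i = "\<lambda>(i, j). (i, Suc j)" and j = "\<lambda>(i, j). (i, j - 1)"]) auto
  then show ?thesis
    by (rule has_sum_cong_neutral[THEN iffD1, rotated -1]) (auto split: if_splits)
qed

text \<open>In the recursion the factor \<open>j + q\<close> splits: its \<open>j\<close> part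
  shifts the series and yields \<open>\<rho> * t\<close>, hence the argument
  \<open>Z - \<rho> * t\<close>; its \<open>q\<close> part is the second term of the recursion at
  \<open>p\<close>, \<open>q\<close>. Only the first argument is multiplied in, so \<open>E\<close>
  and \<open>W'\<close> may be arbitrary.\<close>

lemma ito_poly_generating_function_step:
  fixes \<rho> s t Z W :: "'a :: {real_normed_field, banach}"
  defines "F \<equiv> \<lambda>p q (i, j). s ^ i / fact i * (t ^ j / fact j) * ito_poly \<rho> Z W (i + p) (j + q)"
  assumes F: "(F p q has_sum E * ito_poly \<rho> (Z - \<rho> * t) W' p q) UNIV"
    and F': "q > 0 \<Longrightarrow> (F p (q - 1) has_sum E * ito_poly \<rho> (Z - \<rho> * t) W' p (q - 1)) UNIV"
  shows "(F (Suc p) q has_sum E * ito_poly \<rho> (Z - \<rho> * t) W' (Suc p) q) UNIV"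
proof -
  have F'': "((\<lambda>z. of_nat q * F p (q - 1) z) has_sum of_nat q * (E * ito_poly \<rho> (Z - \<rho> * t) W' p (q - 1))) UNIV"
    using has_sum_cmult_right[OF F'] by (cases "q = 0") auto
  have "F (Suc p) q (i, j) = Z * F p q (i, j) + - (\<rho> * t) * (if j = 0 then 0 else F p q (i, j - 1))
          + - \<rho> * (of_nat q * F p (q - 1) (i, j))" for i j
    by (cases j; cases q)
       (simp_all add: F_def ito_poly_Suc_left field_simps del: of_nat_Suc fact_Suc, simp_all add: field_simps)
  then have eq: "F (Suc p) q = (\<lambda>z. Z * F p q z + - (\<rho> * t) * (case z of (i, j) \<Rightarrow> if j = 0 then 0 else F p q (i, j - 1))
          + - \<rho> * (of_nat q * F p (q - 1) z))"
    by (intro ext) (simp add: case_prod_unfold split_paired_all)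
  have "(F (Suc p) q has_sum Z * (E * ito_poly \<rho> (Z - \<rho> * t) W' p q)
      + - (\<rho> * t) * (E * ito_poly \<rho> (Z - \<rho> * t) W' p q)
      + - \<rho> * (of_nat q * (E * ito_poly \<rho> (Z - \<rho> * t) W' p (q - 1)))) UNIV"
    unfolding eq by (intro has_sum_add has_sum_cmult_right F F'' has_sum_shift_snd)
  then show ?thesis by (simp add: ito_poly_Suc_left algebra_simps)
qed

lemma ito_poly_shifted_generating_function:
  fixes \<rho> :: "'a :: {real_normed_field, banach}"
  shows "((\<lambda>(i, j). s ^ i / fact i * (t ^ j / fact j) * ito_poly \<rho> Z W (i + p) (j + q))
            has_sum exp (s * Z + t * W - \<rho> * s * t) * ito_poly \<rho> (Z - \<rho> * t) (W - \<rho> * s) p q) UNIV"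
proof (induction p arbitrary: q)
  case 0
  \<comment> \<open>For \<open>p = 0\<close> the induction runs over \<open>q\<close> with the roles
    of the two indices exchanged; the step then applies with second index 0, where its second
    premise is vacuous.\<close>
  have "((\<lambda>(j, i). t ^ j / fact j * (s ^ i / fact i) * ito_poly \<rho> W Z (j + q) (i + 0))
      has_sum exp (t * W + s * Z - \<rho> * t * s) * ito_poly \<rho> (W - \<rho> * s) (Z - \<rho> * t) q 0) UNIV"
  proof (induction q)
    case 0
    show ?case using ito_poly_generating_function[of t s \<rho> W Z] by simp
  next
    case (Suc q)
    then show ?case by (rule ito_poly_generating_function_step) simp
  qed
  then show ?case
    using has_sum_swap[where f = "\<lambda>(j, i). t ^ j / fact j * (s ^ i / fact i) * ito_poly \<rho> W Z (j + q) (i + 0)"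
        and A = UNIV and B = UNIV]
    by (simp add: mult_ac add.commute ito_poly_commute[of _ W])
next
  case (Suc p)
  then show ?case by (intro ito_poly_generating_function_step)
qed

section \<open>Diagonal polynomials and the bilinear sum\<close>

lemma has_sum_laguerre_double:
  fixes v y :: "'a :: {real_normed_field, banach}"
  assumes "norm y < 1"
  shows "((\<lambda>(j, k). v ^ j / fact j * (of_nat (j + k choose k) * y ^ k)) has_sum exp (v / (1 - y)) / (1 - y)) UNIV"
proof (rule has_sum_Times_dominated[where g = "\<lambda>j. v ^ j / fact j * (1 / (1 - y)) ^ Suc j"
      and F = "\<lambda>(j, k). norm v ^ j / fact j * (of_nat (j + k choose k) * norm y ^ k)"
      and G = "\<lambda>j. norm v ^ j / fact j * (1 / (1 - norm y)) ^ Suc j"])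
  \<comment> \<open>Summing over \<open>k\<close> first gives the negative binomial series; what is
    left is an exponential series in \<open>v / (1 - y)\<close>. The polymorphic form also serves
    the majorant at the norms.\<close>
  have outer: "((\<lambda>j. v ^ j / fact j * (1 / (1 - y)) ^ Suc j) has_sum exp (v / (1 - y)) / (1 - y)) UNIV"
    for v y :: "'b :: {real_normed_field, banach}"
    using has_sum_cmult_right[OF has_sum_exp[of "v / (1 - y)"], of "1 / (1 - y)"]
    by (simp add: power_divide field_simps)
  show "((\<lambda>j. v ^ j / fact j * (1 / (1 - y)) ^ Suc j) has_sum exp (v / (1 - y)) / (1 - y)) UNIV"
    by (rule outer)
  show "(\<lambda>j. norm v ^ j / fact j * (1 / (1 - norm y)) ^ Suc j) summable_on UNIV"
    by (rule has_sum_imp_summable[OF outer])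
qed (use assms in
      \<open>auto intro!: has_sum_cmult_right has_sum_negative_binomial simp: norm_mult norm_divide norm_power
          simp del: power_Suc times_divide_eq_left times_divide_eq_right times_divide_times_eq\<close>)

text \<open>For \<open>\<rho> \<noteq> 0\<close> the polynomial with equal indices is
  \<open>fact l * (- \<rho>) ^ l\<close> times the Laguerre polynomial of degree \<open>l\<close> at
  \<open>Z * W / \<rho>\<close>, so this is the classical Laguerre generating function.\<close>

lemma ito_poly_diagonal_generating_function:
  fixes \<rho> :: "'a :: {real_normed_field, banach}"
  assumes "norm (\<rho> * x) < 1"
  shows "((\<lambda>l. x ^ l / fact l * ito_poly \<rho> Z W l l)
            has_sum exp (x * Z * W / (1 + \<rho> * x)) / (1 + \<rho> * x)) UNIV"
proof -
  have "(\<Sum>k\<le>l. (x * Z * W) ^ (l - k) / fact (l - k) * (of_nat (l - k + k choose k) * (- (\<rho> * x)) ^ k))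
      = x ^ l / fact l * ito_poly \<rho> Z W l l" for l
    unfolding ito_poly_conv_fact sum_distrib_left
  proof (intro sum.cong)
    fix k assume "k \<in> {..min l l}"
    moreover from this have "x ^ l = x ^ k * x ^ (l - k)"
      by (simp flip: power_add)
    ultimately show "(x * Z * W) ^ (l - k) / fact (l - k) * (of_nat (l - k + k choose k) * (- (\<rho> * x)) ^ k)
      = x ^ l / fact l * (fact l * fact l * ((- \<rho>) ^ k / fact k * (Z ^ (l - k) / fact (l - k)) * (W ^ (l - k) / fact (l - k))))"
      using power_mult_distrib[of "- \<rho>" x k]
      by (simp add: binomial_fact power_mult_distrib field_simps)
  qed simp
  then show ?thesis
    using has_sum_antidiagonal[OF has_sum_laguerre_double[of "- (\<rho> * x)" "x * Z * W"]] assms by simp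
qed

text \<open>For fixed \<open>l\<close> the sum over \<open>i\<close> and \<open>j\<close> is the
  shifted generating function, leaving a diagonal series in \<open>l\<close> at the moved arguments.
  The majorant is the same series at \<open>- norm \<rho>\<close> and the norms, so it converges
  under the same bound on \<open>\<rho> * x\<close>.\<close>

lemma ito_poly_triple_generating_function:
  fixes \<rho> :: "'a :: {real_normed_field, banach}"
  assumes "norm (\<rho> * x) < 1"
  shows "((\<lambda>(l, i, j). x ^ l / fact l * (s ^ i / fact i * (t ^ j / fact j) * ito_poly \<rho> Z W (i + l) (j + l)))
     has_sum exp (s * Z + t * W - \<rho> * s * t) *
       (exp (x * (Z - \<rho> * t) * (W - \<rho> * s) / (1 + \<rho> * x)) / (1 + \<rho> * x))) UNIV"
proof (rule has_sum_Times_dominated[where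
      g = "\<lambda>l. x ^ l / fact l * (exp (s * Z + t * W - \<rho> * s * t) * ito_poly \<rho> (Z - \<rho> * t) (W - \<rho> * s) l l)"
      and F = "\<lambda>(l, i, j). norm x ^ l / fact l * (norm s ^ i / fact i * (norm t ^ j / fact j)
         * ito_poly (- norm \<rho>) (norm Z) (norm W) (i + l) (j + l))"
      and G = "\<lambda>l. norm x ^ l / fact l * (exp (norm s * norm Z + norm t * norm W - (- norm \<rho>) * norm s * norm t)
         * ito_poly (- norm \<rho>) (norm Z - (- norm \<rho>) * norm t) (norm W - (- norm \<rho>) * norm s) l l)"])
  have outer: "((\<lambda>l. x ^ l / fact l * (E * ito_poly \<rho> Z W l l)) has_sum
       E * (exp (x * Z * W / (1 + \<rho> * x)) / (1 + \<rho> * x))) UNIV"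
    if "norm (\<rho> * x) < 1" for \<rho> x Z W E :: "'b :: {real_normed_field, banach}"
    using has_sum_cmult_right[OF ito_poly_diagonal_generating_function[OF that, of Z W], of E]
    by (simp add: mult_ac)
  show "((\<lambda>l. x ^ l / fact l * (exp (s * Z + t * W - \<rho> * s * t) * ito_poly \<rho> (Z - \<rho> * t) (W - \<rho> * s) l l))
     has_sum exp (s * Z + t * W - \<rho> * s * t) *
       (exp (x * (Z - \<rho> * t) * (W - \<rho> * s) / (1 + \<rho> * x)) / (1 + \<rho> * x))) UNIV"
    using assms by (rule outer)
  show "(\<lambda>l. norm x ^ l / fact l * (exp (norm s * norm Z + norm t * norm W - (- norm \<rho>) * norm s * norm t)
         * ito_poly (- norm \<rho>) (norm Z - (- norm \<rho>) * norm t) (norm W - (- norm \<rho>) * norm s) l l)) summable_on UNIV"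
    using assms by (intro has_sum_imp_summable[OF outer]) (simp add: norm_mult)
qed (use ito_poly_shifted_generating_function
      ito_poly_shifted_generating_function[of "norm s" "norm t" "- norm \<rho>"] norm_ito_poly_le in
      \<open>auto intro!: has_sum_cmult_right mult_left_mono
         simp: case_prod_unfold norm_mult norm_divide norm_power
          simp del: times_divide_eq_left times_divide_eq_right times_divide_times_eq\<close>)

text \<open>Expanding only the second polynomial, with summation index \<open>l\<close>, turns the sum into the triple
  generating function at \<open>x = - a b \<rho>\<close>, \<open>s = a Z'\<close>, \<open>t = b W'\<close>.\<close>

theorem ito_poly_mehler:
  fixes \<rho> a b Z W Z' W' :: "'a :: {real_normed_field, banach}"
  assumes "norm (\<rho>\<^sup>2 * a * b) < 1"
  shows "((\<lambda>(m, n). a ^ m * b ^ n / (fact m * fact n) * ito_poly \<rho> Z W m n * ito_poly \<rho> Z' W' m n) has_sum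
     exp ((a * Z * Z' + b * W * W' - \<rho> * a * b * (Z * W + Z' * W')) / (1 - \<rho>\<^sup>2 * a * b)) / (1 - \<rho>\<^sup>2 * a * b)) UNIV"
proof -
  define x s t where "x = - (a * b * \<rho>)" and "s = a * Z'" and "t = b * W'"
  have x: "\<rho> * x = - (\<rho>\<^sup>2 * a * b)"
    by (simp add: x_def power2_eq_square)
  have ne: "1 - \<rho>\<^sup>2 * a * b \<noteq> 0"
    using assms by auto
  have "(\<Sum>l\<le>min m n. x ^ l / fact l * (s ^ (m - l) / fact (m - l) * (t ^ (n - l) / fact (n - l)) * ito_poly \<rho> Z W (m - l + l) (n - l + l)))
     = a ^ m * b ^ n / (fact m * fact n) * ito_poly \<rho> Z W m n * ito_poly \<rho> Z' W' m n" for m n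
    unfolding ito_poly_conv_fact[of \<rho> Z'] sum_distrib_left
  proof (intro sum.cong refl)
    fix l assume l: "l \<in> {..min m n}"
    then have ab: "a ^ m = a ^ l * a ^ (m - l)" "b ^ n = b ^ l * b ^ (n - l)"
      by (simp_all flip: power_add)
    have x: "x ^ l = a ^ l * b ^ l * (- \<rho>) ^ l"
      by (simp add: x_def flip: power_mult_distrib)
    show "x ^ l / fact l * (s ^ (m - l) / fact (m - l) * (t ^ (n - l) / fact (n - l)) * ito_poly \<rho> Z W (m - l + l) (n - l + l))
      = a ^ m * b ^ n / (fact m * fact n) * ito_poly \<rho> Z W m n * (fact m * fact n * ((- \<rho>) ^ l / fact l * (Z' ^ (m - l) / fact (m - l)) * (W' ^ (n - l) / fact (n - l))))"
      using l by (simp only: x ab s_def t_def power_mult_distrib) (simp add: field_simps)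
  qed
  moreover have "s * Z + t * W - \<rho> * s * t + x * (Z - \<rho> * t) * (W - \<rho> * s) / (1 + \<rho> * x)
     = (a * Z * Z' + b * W * W' - \<rho> * a * b * (Z * W + Z' * W')) / (1 - \<rho>\<^sup>2 * a * b)"
    using ne unfolding x by (simp add: x_def s_def t_def field_simps power2_eq_square)
  ultimately show ?thesis
    using has_sum_diagonal[OF ito_poly_triple_generating_function[of \<rho> x s t Z W]] assms
    by (simp add: x mult_exp_exp)
qed

subsection \<open>The differential operators and the pointwise formula\<close>

lemma has_vector_derivative_power_mult:
  fixes f g :: "real \<Rightarrow> complex"
  assumes "(f has_vector_derivative f') (at t)" "(g has_vector_derivative g') (at t)"
  shows "((\<lambda>t. f t ^ p * g t ^ q) has_vector_derivative
            (of_nat p * f t ^ (p - 1) * f') * g t ^ q + f t ^ p * (of_nat q * g t ^ (q - 1) * g')) (at t)"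
  using assms unfolding has_vector_derivative_def
  by (auto intro!: derivative_eq_intros simp: fun_eq_iff scaleR_conv_of_real algebra_simps)

lemma has_vector_derivative_Complex_Re:
  "((\<lambda>t. Complex t y) has_vector_derivative 1) (at t)"
  "((\<lambda>t. cnj (Complex t y)) has_vector_derivative 1) (at t)"
proof -
  have eq: "(\<lambda>t. Complex t y) = (\<lambda>t. of_real t + \<i> * of_real y)"
    by (simp add: fun_eq_iff complex_eq_iff)
  show "((\<lambda>t. Complex t y) has_vector_derivative 1) (at t)"
    unfolding eq by (auto intro!: derivative_eq_intros)
  from has_vector_derivative_cnj[OF this]
  show "((\<lambda>t. cnj (Complex t y)) has_vector_derivative 1) (at t)" by simp
qed

lemma has_vector_derivative_Complex_Im:
  "((\<lambda>t. Complex x t) has_vector_derivative \<i>) (at t)"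
  "((\<lambda>t. cnj (Complex x t)) has_vector_derivative - \<i>) (at t)"
proof -
  have eq: "(\<lambda>t. Complex x t) = (\<lambda>t. of_real x + \<i> * of_real t)"
    by (simp add: fun_eq_iff complex_eq_iff)
  show "((\<lambda>t. Complex x t) has_vector_derivative \<i>) (at t)"
    unfolding eq by (auto intro!: derivative_eq_intros)
  from has_vector_derivative_cnj[OF this]
  show "((\<lambda>t. cnj (Complex x t)) has_vector_derivative - \<i>) (at t)" by simp
qed

context
  fixes K :: "'i set" and c :: "'i \<Rightarrow> complex" and p q :: "'i \<Rightarrow> nat"
begin

text \<open>A family of monomials covers both the polynomials, with \<open>K = {..n}\<close>, and
  single monomials, with a one-point \<open>K\<close>. Where an exponent is 0 the truncated
  \<open>p k - 1\<close> or \<open>q k - 1\<close> comes with factor 0.\<close>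

lemma partial_1_sum_monomials:
  "partial_1 (\<lambda>z. \<Sum>k\<in>K. c k * (z ^ p k * cnj z ^ q k)) z =
     (\<Sum>k\<in>K. c k * (of_nat (p k) * z ^ (p k - 1) * cnj z ^ q k + of_nat (q k) * z ^ p k * cnj z ^ (q k - 1)))"
  unfolding partial_1_def
proof (rule vector_derivative_at)
  show "((\<lambda>t. \<Sum>k\<in>K. c k * (Complex t (Im z) ^ p k * cnj (Complex t (Im z)) ^ q k)) has_vector_derivative
     (\<Sum>k\<in>K. c k * (of_nat (p k) * z ^ (p k - 1) * cnj z ^ q k + of_nat (q k) * z ^ p k * cnj z ^ (q k - 1)))) (at (Re z))"
    by (intro has_vector_derivative_sum has_vector_derivative_mult_right
          has_vector_derivative_eq_rhs[OF has_vector_derivative_power_mult[OF has_vector_derivative_Complex_Re]])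
       simp
qed

lemma partial_2_sum_monomials:
  "partial_2 (\<lambda>z. \<Sum>k\<in>K. c k * (z ^ p k * cnj z ^ q k)) z =
     (\<Sum>k\<in>K. \<i> * (c k * (of_nat (p k) * z ^ (p k - 1) * cnj z ^ q k - of_nat (q k) * z ^ p k * cnj z ^ (q k - 1))))"
  unfolding partial_2_def
proof (rule vector_derivative_at)
  show "((\<lambda>t. \<Sum>k\<in>K. c k * (Complex (Re z) t ^ p k * cnj (Complex (Re z) t) ^ q k)) has_vector_derivative
     (\<Sum>k\<in>K. \<i> * (c k * (of_nat (p k) * z ^ (p k - 1) * cnj z ^ q k - of_nat (q k) * z ^ p k * cnj z ^ (q k - 1))))) (at (Im z))"
    by (intro has_vector_derivative_sum
          has_vector_derivative_eq_rhs[OF has_vector_derivative_mult_right[OF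
            has_vector_derivative_power_mult[OF has_vector_derivative_Complex_Im]]])
       (simp add: algebra_simps)
qed

text \<open>\<open>z\<close> and \<open>cnj z\<close> behave as independent variables: in this
  combination of the two partials the terms differentiating \<open>cnj z\<close> cancel.\<close>

lemma d_z_sum_monomials:
  "d_z (\<lambda>z. \<Sum>k\<in>K. c k * (z ^ p k * cnj z ^ q k)) z =
     (\<Sum>k\<in>K. c k * (of_nat (p k) * z ^ (p k - 1) * cnj z ^ q k))"
  unfolding d_z_def partial_1_sum_monomials partial_2_sum_monomials sum_distrib_left sum_subtractf[symmetric]
  by (intro sum.cong refl) (simp add: algebra_simps)

lemma d_zbar_sum_monomials:
  "d_zbar (\<lambda>z. \<Sum>k\<in>K. c k * (z ^ p k * cnj z ^ q k)) z =
     (\<Sum>k\<in>K. c k * (of_nat (q k) * z ^ p k * cnj z ^ (q k - 1)))"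
  unfolding d_zbar_def partial_1_sum_monomials partial_2_sum_monomials sum_distrib_left sum.distrib[symmetric]
  by (intro sum.cong refl) (simp add: algebra_simps)

end

text \<open>The lowering relation, termwise from
  \<open>(n choose k) * (n - k) = n * (n - 1 choose k)\<close>. The constant \<open>C\<close>
  carries the powers of \<open>1 / \<rho>\<close> that accumulate when \<open>d_star\<close> is
  iterated.\<close>

lemma d_zbar_ito_poly:
  "d_zbar (\<lambda>z. C * ito_poly \<rho> z (cnj z) m n) z = C * of_nat n * ito_poly \<rho> z (cnj z) m (n - 1)"
proof (cases n)
  case 0
  then show ?thesis
    using d_zbar_sum_monomials[of "\<lambda>_. C" "\<lambda>_. m" "\<lambda>_. 0" "{0 :: nat}"] by simp
next
  case (Suc n')
  let ?c = "\<lambda>k. C * (fact k * of_nat (m choose k) * of_nat (n choose k) * (- \<rho>) ^ k)"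
  have absorb: "of_nat (n choose k) * of_nat (n - k) = (of_nat n * of_nat (n' choose k) :: complex)" for k
    using binomial_absorb_comp[of n k] Suc
    unfolding of_nat_mult[symmetric] by (simp only: mult.commute) simp
  have "d_zbar (\<lambda>z. C * ito_poly \<rho> z (cnj z) m n) z = d_zbar (\<lambda>z. \<Sum>k\<le>n. ?c k * (z ^ (m - k) * cnj z ^ (n - k))) z"
    by (simp only: ito_poly_def sum_distrib_left mult.assoc)
  also have "\<dots> = (\<Sum>k\<le>n. ?c k * (of_nat (n - k) * z ^ (m - k) * cnj z ^ (n - k - 1)))"
    by (rule d_zbar_sum_monomials)
  \<comment> \<open>The term \<open>k = n\<close> is constant in \<open>cnj z\<close> and has factor
    \<open>n - k = 0\<close>.\<close>
  also have "\<dots> = (\<Sum>k\<le>n'. ?c k * (of_nat (n - k) * z ^ (m - k) * cnj z ^ (n - k - 1)))"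
    by (rule sum.mono_neutral_right) (auto simp: Suc)
  also have "\<dots> = (\<Sum>k\<le>n'. C * of_nat n * (fact k * of_nat (m choose k) * of_nat (n' choose k) * (- \<rho>) ^ k * z ^ (m - k) * cnj z ^ (n' - k)))"
  proof (intro sum.cong refl)
    fix k
    have "?c k * (of_nat (n - k) * z ^ (m - k) * cnj z ^ (n - k - 1))
       = C * (of_nat (n choose k) * of_nat (n - k)) * (fact k * of_nat (m choose k) * (- \<rho>) ^ k * z ^ (m - k) * cnj z ^ (n - k - 1))"
      by (simp only: mult_ac)
    also have "\<dots> = C * of_nat n * (fact k * of_nat (m choose k) * of_nat (n' choose k) * (- \<rho>) ^ k * z ^ (m - k) * cnj z ^ (n' - k))"
      unfolding absorb by (simp add: Suc mult_ac)
    finally show "?c k * (of_nat (n - k) * z ^ (m - k) * cnj z ^ (n - k - 1)) =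
       C * of_nat n * (fact k * of_nat (m choose k) * of_nat (n' choose k) * (- \<rho>) ^ k * z ^ (m - k) * cnj z ^ (n' - k))" .
  qed
  also have "\<dots> = C * of_nat n * ito_poly \<rho> z (cnj z) m n'"
    unfolding ito_poly_def sum_distrib_left ..
  finally show ?thesis by (simp add: Suc)
qed

lemma dbar_star_funpow: "(dbar_star \<rho> ^^ n) (\<lambda>_. 1) = (\<lambda>z. (1 / of_real \<rho>) ^ n * cnj z ^ n)"
proof (induction n)
  case (Suc n)
  have "d_z (\<lambda>z. (1 / of_real \<rho>) ^ n * cnj z ^ n) z = 0" for z
    using d_z_sum_monomials[of "\<lambda>_. (1 / of_real \<rho>) ^ n" "\<lambda>_. 0" "\<lambda>_. n" "{0 :: nat}"] by simp
  then show ?case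
    unfolding funpow.simps o_apply Suc by (intro ext) (simp add: dbar_star_def)
qed simp

text \<open>By the lowering relation, \<open>d_star\<close> acts on the scaled polynomial as the
  first-index recursion divided by \<open>\<rho>\<close>; the prefactor
  \<open>\<rho> ^ (m + n)\<close> clears the accumulated denominators.\<close>

lemma hermite_laguerre_ito_eq_ito_poly:
  assumes "\<rho> \<noteq> 0"
  shows "hermite_laguerre_ito m n z \<rho> = ito_poly (of_real \<rho>) z (cnj z) m n"
proof -
  have "(d_star \<rho> ^^ m) ((dbar_star \<rho> ^^ n) (\<lambda>_. 1))
    = (\<lambda>z. (1 / of_real \<rho>) ^ (m + n) * ito_poly (of_real \<rho>) z (cnj z) m n)"
  proof (induction m)
    case (Suc m)
    show ?case
      unfolding funpow.simps o_apply Suc using assms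
      by (intro ext, simp only: d_star_def d_zbar_ito_poly ito_poly_Suc_left) (simp add: field_simps)
  qed (simp add: dbar_star_funpow)
  then show ?thesis using assms by (simp add: hermite_laguerre_ito_def power_divide)
qed

section \<open>From the plane to complex numbers, and the Mehler terms\<close>

lemma cnj_ito_poly: "cnj (ito_poly (of_real \<rho>) z w m n) = ito_poly (of_real \<rho>) (cnj z) (cnj w) m n"
  by (simp add: ito_poly_def)

definition complex_of_R2 :: "real^2 \<Rightarrow> complex" where
  "complex_of_R2 x = Complex (x $ 1) (x $ 2)"

lemma hermite_laguerre_ito_R2_eq:
  "\<rho> \<noteq> 0 \<Longrightarrow> hermite_laguerre_ito_R2 \<rho> m n x
     = ito_poly (of_real \<rho>) (complex_of_R2 x) (cnj (complex_of_R2 x)) m n"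
  by (simp add: hermite_laguerre_ito_R2_def complex_of_R2_def hermite_laguerre_ito_eq_ito_poly)

lemma norm_R2_eq: "(norm x)\<^sup>2 = (cmod (complex_of_R2 x))\<^sup>2" for x :: "real^2"
  by (simp add: complex_of_R2_def cmod_power2 norm_vec_def L2_set_def sum_2)

text \<open>\<open>rot_B0 \<Omega> t\<close> turns clockwise by \<open>\<Omega> * t\<close>, that
  is, multiplies by \<open>cis (- \<Omega> * t)\<close>; at \<open>t = - (1 / r) * ln u\<close> the
  two signs cancel.\<close>

lemma inner_rot_Btilde0:
  "(rot_Btilde0 \<Omega> r u *v x) \<bullet> y
     = Re (cis (\<Omega> / r * ln u) * complex_of_R2 x * cnj (complex_of_R2 y))"
  by (simp add: rot_Btilde0_def rot_B0_def complex_of_R2_def inner_vec_def sum_2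
      matrix_vector_mult_def algebra_simps)

text \<open>Splitting the exponent into its \<open>m\<close> and \<open>n\<close> parts gives, up to
  the factor \<open>1 / \<rho>\<close>, the bases \<open>a\<close> and \<open>b\<close> of the
  bilinear formula.\<close>

lemma mehler_coefficient:
  assumes "0 < u"
  shows "of_real u powr (of_nat (m + n) + \<i> * (of_nat m - of_nat n) * of_real c)
     = (of_real u * cis (c * ln u)) ^ m * (of_real u * cis (- (c * ln u))) ^ n"
proof -
  have u: "of_real u = exp (complex_of_real (ln u))"
    using assms by (simp add: exp_of_real)
  have "(of_real u :: complex) \<noteq> 0" using assms by simp
  then have "of_real u powr (of_nat (m + n) + \<i> * (of_nat m - of_nat n) * of_real c)
     = exp ((of_nat (m + n) + \<i> * (of_nat m - of_nat n) * of_real c) * of_real (ln u))"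
    using assms by (simp add: powr_def Ln_of_real)
  also have "\<dots> = exp (of_nat m * (of_real (ln u) + \<i> * of_real (c * ln u))
         + of_nat n * (of_real (ln u) + \<i> * of_real (- (c * ln u))))"
    by (rule arg_cong[where f = exp]) (simp add: algebra_simps)
  finally show ?thesis
    unfolding exp_add exp_of_nat_mult u cis_conv_exp by simp
qed

lemma mehler_term_eq:
  fixes \<rho> c u :: real
  assumes "\<rho> \<noteq> 0" "0 < u"
  defines "\<theta> \<equiv> c * ln u"
  shows "mehler_term \<rho> c u m n x y =
     (of_real (u / \<rho>) * cis \<theta>) ^ m * (of_real (u / \<rho>) * cis (- \<theta>)) ^ n / (fact m * fact n)
       * ito_poly (of_real \<rho>) (complex_of_R2 x) (cnj (complex_of_R2 x)) m n
       * ito_poly (of_real \<rho>) (cnj (complex_of_R2 y)) (complex_of_R2 y) m n"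
  using assms
  unfolding mehler_term_def mehler_coefficient[OF assms(2)] hermite_laguerre_ito_R2_eq[OF assms(1)] cnj_ito_poly
  by (simp add: power_mult_distrib power_divide power_add field_simps)

lemma has_sum_mehler_term:
  assumes "\<rho> > 0" "0 < u" "u < 1"
  shows "((\<lambda>(m, n). mehler_term \<rho> (\<Omega> / r) u m n x y) has_sum of_real (mehler_kernel \<rho> \<Omega> r u x y)) UNIV"
proof -
  define \<theta> where "\<theta> = \<Omega> / r * ln u"
  define z w where "z = complex_of_R2 x" and "w = complex_of_R2 y"
  define a b where "a = of_real (u / \<rho>) * cis \<theta>" and "b = of_real (u / \<rho>) * cis (- \<theta>)"
  have u: "u\<^sup>2 < 1" using assms by (simp add: power_less_one_iff)
  \<comment> \<open>The phases cancel, so the convergence condition of the bilinear formula reduces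
    to \<open>u\<^sup>2 < 1\<close>.\<close>
  have "a * b = of_real ((u / \<rho>)\<^sup>2) * (cis \<theta> * cis (- \<theta>))"
    by (simp add: a_def b_def power2_eq_square)
  then have ab: "a * b = of_real ((u / \<rho>)\<^sup>2)" by (simp add: cis_mult)
  then have \<rho>ab: "(of_real \<rho>)\<^sup>2 * a * b = of_real (u\<^sup>2)" "of_real \<rho> * a * b = of_real (u\<^sup>2 / \<rho>)"
    using assms by (simp_all add: mult.assoc power_divide) (simp add: power2_eq_square)
  \<comment> \<open>The two mixed terms are complex conjugates, so their sum is twice a real part,
    which gives the rotated inner product.\<close>
  have lin: "a * z * cnj w + b * cnj z * w = of_real (2 * u / \<rho> * ((rot_Btilde0 \<Omega> r u *v x) \<bullet> y))"
  proof -
    have conj: "b * cnj z * w = cnj (a * z * cnj w)"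
      by (simp add: a_def b_def cis_cnj)
    have "a * z * cnj w + b * cnj z * w = of_real (2 * Re (a * z * cnj w))"
      unfolding conj by (rule complex_add_cnj)
    also have "Re (a * z * cnj w) = u / \<rho> * Re (cis \<theta> * z * cnj w)"
      unfolding a_def by (simp only: mult.assoc Re_complex_of_real) simp
    also have "Re (cis \<theta> * z * cnj w) = (rot_Btilde0 \<Omega> r u *v x) \<bullet> y"
      by (simp add: inner_rot_Btilde0 \<theta>_def z_def w_def)
    finally show ?thesis by simp
  qed
  have quad: "z * cnj z + cnj w * w = of_real ((norm x)\<^sup>2 + (norm y)\<^sup>2)"
    by (simp only: norm_R2_eq z_def w_def of_real_add complex_norm_square mult.commute)
  have "(a * z * cnj w + b * cnj z * w - of_real \<rho> * a * b * (z * cnj z + cnj w * w)) / (1 - (of_real \<rho>)\<^sup>2 * a * b)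
      = of_real ((2 * u / \<rho> * ((rot_Btilde0 \<Omega> r u *v x) \<bullet> y) - u\<^sup>2 / \<rho> * ((norm x)\<^sup>2 + (norm y)\<^sup>2)) / (1 - u\<^sup>2))"
    unfolding lin quad \<rho>ab by simp
  also have "(2 * u / \<rho> * ((rot_Btilde0 \<Omega> r u *v x) \<bullet> y) - u\<^sup>2 / \<rho> * ((norm x)\<^sup>2 + (norm y)\<^sup>2)) / (1 - u\<^sup>2)
      = - (u\<^sup>2 * (norm y)\<^sup>2 + u\<^sup>2 * (norm x)\<^sup>2 - 2 * u * ((rot_Btilde0 \<Omega> r u *v x) \<bullet> y)) / (\<rho> * (1 - u\<^sup>2))"
    using assms u by (simp add: divide_simps) (simp add: algebra_simps)
  finally have "exp ((a * z * cnj w + b * cnj z * w - of_real \<rho> * a * b * (z * cnj z + cnj w * w)) / (1 - (of_real \<rho>)\<^sup>2 * a * b))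
      / (1 - (of_real \<rho>)\<^sup>2 * a * b) = of_real (mehler_kernel \<rho> \<Omega> r u x y)"
    unfolding mehler_kernel_def by (simp only: exp_of_real \<rho>ab(1)) simp
  moreover have "norm ((of_real \<rho>)\<^sup>2 * a * b) < 1"
    unfolding \<rho>ab norm_of_real using u by simp
  ultimately show ?thesis
    using ito_poly_mehler[of "of_real \<rho>" a b z "cnj z" "cnj w" w] assms
    by (simp add: mehler_term_eq a_def b_def z_def w_def \<theta>_def)
qed

subsection \<open>Gaussian integrability\<close>

text \<open>The integrand factors over an orthonormal basis into one-dimensional Gaussians, each a
  multiple of a normal density with variance \<open>1 / (2 * \<epsilon>)\<close>.\<close>

lemma integrable_exp_neg_norm_square:
  assumes "\<epsilon> > 0"
  shows "integrable lborel (\<lambda>x :: 'a :: euclidean_space. exp (- \<epsilon> * (norm x)\<^sup>2))"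
proof -
  define \<sigma> where "\<sigma> = sqrt (1 / (2 * \<epsilon>))"
  have \<sigma>: "\<sigma> > 0" "\<sigma>\<^sup>2 = 1 / (2 * \<epsilon>)"
    using assms by (simp_all add: \<sigma>_def)
  have "integrable lborel (\<lambda>t. sqrt (2 * pi * \<sigma>\<^sup>2) * normal_density 0 \<sigma> t)"
    using \<sigma> by (intro integrable_mult_right integrable_normal_density)
  also have "(\<lambda>t. sqrt (2 * pi * \<sigma>\<^sup>2) * normal_density 0 \<sigma> t) = (\<lambda>t. exp (- \<epsilon> * t\<^sup>2))"
    using \<sigma> assms by (simp add: normal_density_def fun_eq_iff)
  finally have int: "integrable lborel (\<lambda>t :: real. exp (- \<epsilon> * t\<^sup>2))" .
  have norm: "exp (- \<epsilon> * (norm x)\<^sup>2) = (\<Prod>b\<in>Basis. exp (- \<epsilon> * (x \<bullet> b)\<^sup>2))" for x :: 'a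
    unfolding norm_eq_sqrt_inner
    by (subst euclidean_inner[of x x]) (simp add: sum_nonneg exp_sum[symmetric] sum_distrib_left power2_eq_square)
  have "(\<integral>\<^sup>+x. ennreal (exp (- \<epsilon> * (norm x)\<^sup>2)) \<partial>(lborel :: 'a measure))
      = (\<Prod>b\<in>(Basis :: 'a set). (\<integral>\<^sup>+t. ennreal (exp (- \<epsilon> * t\<^sup>2)) \<partial>lborel))"
    unfolding norm prod_ennreal[OF exp_ge_zero, symmetric]
    by (rule nn_integral_lborel_prod[where f = "\<lambda>_ t. ennreal (exp (- \<epsilon> * t\<^sup>2))"]) auto
  also have "\<dots> < \<infinity>"
    using int by (auto simp: integrable_iff_bounded power_eq_top_ennreal less_top[symmetric])
  finally show ?thesis
    by (intro integrableI_nonneg) auto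
qed

text \<open>The density contributes decay rate \<open>1 / \<rho>\<close>, so the product is a
  Gaussian of positive rate \<open>1 / \<rho> - s\<close>.\<close>

lemma integrable_gauss_measure_exp:
  assumes "\<rho> > 0" "s < 1 / \<rho>"
  shows "integrable (gauss_measure \<rho>) (\<lambda>x. exp (s * (norm x)\<^sup>2))"
proof -
  have "integrable lborel (\<lambda>x :: real^2. 1 / (pi * \<rho>) * exp (- (1 / \<rho> - s) * (norm x)\<^sup>2))"
    using assms by (intro integrable_mult_right integrable_exp_neg_norm_square) simp
  also have "(\<lambda>x :: real^2. 1 / (pi * \<rho>) * exp (- (1 / \<rho> - s) * (norm x)\<^sup>2))
      = (\<lambda>x. (1 / (pi * \<rho>) * exp (- (norm x)\<^sup>2 / \<rho>)) *\<^sub>R exp (s * (norm x)\<^sup>2))"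
    by (auto simp: fun_eq_iff mult_exp_exp algebra_simps)
  finally show ?thesis
    unfolding gauss_measure_def using assms by (subst integrable_density) auto
qed

lemma sigma_finite_gauss_measure:
  assumes "\<rho> > 0"
  shows "sigma_finite_measure (gauss_measure \<rho>)"
proof -
  have "integrable (gauss_measure \<rho>) (\<lambda>x. 1 :: real)"
    using integrable_gauss_measure_exp[of \<rho> 0] assms by simp
  then have "finite_measure (gauss_measure \<rho>)"
    by (auto intro!: finite_measureI simp: integrable_iff_bounded less_top)
  then show ?thesis by (rule finite_measure.axioms)
qed

lemma (in pair_sigma_finite) integrable_times_integral_times:
  fixes f g :: "_ \<Rightarrow> real"
  assumes f: "integrable M1 f" and g: "integrable M2 g"
  shows integrable_times: "integrable (M1 \<Otimes>\<^sub>M M2) (\<lambda>(x, y). f x * g y)"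
    and integral_times: "(LINT z|(M1 \<Otimes>\<^sub>M M2). (case z of (x, y) \<Rightarrow> f x * g y)) = (LINT x|M1. f x) * (LINT y|M2. g y)"
proof -
  have [measurable]: "f \<in> borel_measurable M1" "g \<in> borel_measurable M2"
    using f g by auto
  show int: "integrable (M1 \<Otimes>\<^sub>M M2) (\<lambda>(x, y). f x * g y)"
    using f g by (intro Fubini_integrable) (auto simp: abs_mult)
  show "(LINT z|(M1 \<Otimes>\<^sub>M M2). (case z of (x, y) \<Rightarrow> f x * g y)) = (LINT x|M1. f x) * (LINT y|M2. g y)"
    using integral_fst'[OF int] by simp
qed

subsection \<open>Convergence in mean square\<close>

lemma norm_sum_square_le:
  fixes a :: "'i \<Rightarrow> 'b :: real_normed_vector"
  assumes "\<And>i. i \<in> I \<Longrightarrow> (norm (a i))\<^sup>2 \<le> b i * c i" "\<And>i. i \<in> I \<Longrightarrow> 0 \<le> b i" "\<And>i. i \<in> I \<Longrightarrow> 0 \<le> c i"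
  shows "(norm (\<Sum>i\<in>I. a i))\<^sup>2 \<le> (\<Sum>i\<in>I. b i) * (\<Sum>i\<in>I. c i)"
proof -
  have "norm (a i) \<le> sqrt (b i) * sqrt (c i)" if "i \<in> I" for i
    using assms[OF that] by (simp add: real_le_rsqrt flip: real_sqrt_mult)
  then have "norm (\<Sum>i\<in>I. a i) \<le> (\<Sum>i\<in>I. sqrt (b i) * sqrt (c i))"
    by (rule sum_norm_le)
  then have "(norm (\<Sum>i\<in>I. a i))\<^sup>2 \<le> (\<Sum>i\<in>I. sqrt (b i) * sqrt (c i))\<^sup>2"
    by (intro power_mono) auto
  also have "\<dots> \<le> (\<Sum>i\<in>I. (sqrt (b i))\<^sup>2) * (\<Sum>i\<in>I. (sqrt (c i))\<^sup>2)"
    by (rule Cauchy_Schwarz_ineq_sum)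
  also have "\<dots> = (\<Sum>i\<in>I. b i) * (\<Sum>i\<in>I. c i)"
    using assms by simp
  finally show ?thesis .
qed

text \<open>Cauchy-Schwarz on \<open>G - F\<close> bounds the partial remainder by those of
  \<open>b\<close> and \<open>c\<close>, themselves at most the full remainders; then
  \<open>G\<close> grows to all indices.\<close>

lemma norm_sum_minus_has_sum_square_le:
  fixes a :: "'i \<Rightarrow> 'b :: real_normed_vector"
  assumes a: "(a has_sum s) UNIV" and b: "(b has_sum B) UNIV" and c: "(c has_sum C) UNIV"
    and le: "\<And>i. (norm (a i))\<^sup>2 \<le> b i * c i" and nn: "\<And>i. 0 \<le> b i" "\<And>i. 0 \<le> c i"
    and F: "finite F"
  shows "(norm ((\<Sum>i\<in>F. a i) - s))\<^sup>2 \<le> (B - (\<Sum>i\<in>F. b i)) * (C - (\<Sum>i\<in>F. c i))"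
proof (rule tendsto_upperbound[where F = "finite_subsets_at_top UNIV"])
  show "((\<lambda>G. (norm ((\<Sum>i\<in>F. a i) - sum a G))\<^sup>2) \<longlongrightarrow> (norm ((\<Sum>i\<in>F. a i) - s))\<^sup>2) (finite_subsets_at_top UNIV)"
    using a unfolding has_sum_def by (intro tendsto_intros)
  show "\<forall>\<^sub>F G in finite_subsets_at_top UNIV.
      (norm ((\<Sum>i\<in>F. a i) - sum a G))\<^sup>2 \<le> (B - (\<Sum>i\<in>F. b i)) * (C - (\<Sum>i\<in>F. c i))"
    unfolding eventually_finite_subsets_at_top
  proof (intro exI[of _ F] conjI allI impI)
    fix G assume G: "finite G \<and> F \<subseteq> G \<and> G \<subseteq> UNIV"
    then have diff: "sum h G = sum h F + sum h (G - F)" for h :: "'i \<Rightarrow> 'd :: real_normed_vector"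
      using sum.subset_diff[of F G h] by (simp add: add.commute)
    have "(norm (\<Sum>i\<in>G - F. a i))\<^sup>2 \<le> (\<Sum>i\<in>G - F. b i) * (\<Sum>i\<in>G - F. c i)"
      using le nn by (intro norm_sum_square_le)
    also have "\<dots> \<le> (B - (\<Sum>i\<in>F. b i)) * (C - (\<Sum>i\<in>F. c i))"
      using finite_sum_le_has_sum[OF b, of G] finite_sum_le_has_sum[OF b F]
        finite_sum_le_has_sum[OF c, of G] G nn
      by (intro mult_mono) (auto simp: diff[of b] diff[of c] sum_nonneg)
    finally show "(norm ((\<Sum>i\<in>F. a i) - sum a G))\<^sup>2 \<le> (B - (\<Sum>i\<in>F. b i)) * (C - (\<Sum>i\<in>F. c i))"
      by (simp add: diff[of a])
  qed (use F in auto)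
qed simp

lemma finite_to_nat_less: "finite {i :: 'i :: countable. to_nat i < N}"
  by (rule finite_imageD[of to_nat]) (auto intro: finite_subset[of _ "{..<N}"] inj_on_subset[OF inj_to_nat])

text \<open>Initial segments of an enumeration eventually contain every finite set, so limits over
  finite sets pass to a sequence, as dominated convergence and measurability of limits
  require.\<close>

lemma filterlim_to_nat_initial_segments:
  "filterlim (\<lambda>N. {i :: 'i :: countable. to_nat i < N}) (finite_subsets_at_top UNIV) sequentially"
  unfolding filterlim_finite_subsets_at_top
proof (intro allI impI)
  fix X :: "'i set" assume X: "finite X \<and> X \<subseteq> UNIV"
  then obtain k where k: "\<forall>n\<in>to_nat ` X. n < k"
    using finite_nat_set_iff_bounded[of "to_nat ` X"] by auto
  with k show "\<forall>\<^sub>F N in sequentially. finite {i :: 'i. to_nat i < N} \<and> X \<subseteq> {i. to_nat i < N} \<and> {i. to_nat i < N} \<subseteq> UNIV"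
    unfolding eventually_sequentially
    by (intro exI[of _ k]) (force simp: finite_to_nat_less)
qed

lemma has_sum_imp_integral_remainder_tendsto_0:
  fixes A :: "'i :: countable \<Rightarrow> 'a \<Rightarrow> real"
  assumes A [measurable]: "\<And>i. A i \<in> borel_measurable M" and nn: "\<And>i x. 0 \<le> A i x"
    and sum: "\<And>x. ((\<lambda>i. A i x) has_sum K x) UNIV" and K: "integrable M K"
  shows "((\<lambda>F. LINT x|M. (K x - (\<Sum>i\<in>F. A i x))) \<longlongrightarrow> 0) (finite_subsets_at_top UNIV)"
proof -
  have [measurable]: "K \<in> borel_measurable M" using K by auto
  have bounds: "0 \<le> K x - (\<Sum>i\<in>F. A i x)" "K x - (\<Sum>i\<in>F. A i x) \<le> K x" if "finite F" for F x
    using finite_sum_le_has_sum[OF sum, of F x] that nn by (auto intro: sum_nonneg)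
  have int: "integrable M (\<lambda>x. K x - (\<Sum>i\<in>F. A i x))" if "finite F" for F
    by (rule Bochner_Integration.integrable_bound[OF K]) (use bounds[OF that] in \<open>auto intro!: AE_I2 order_trans[OF _ abs_ge_self]\<close>)
  let ?F = "\<lambda>N. {i :: 'i. to_nat i < N}"
  note fin = finite_to_nat_less
  have "(\<lambda>N. LINT x|M. (K x - (\<Sum>i\<in>?F N. A i x))) \<longlonglongrightarrow> (LINT x|M. 0)"
  proof (rule integral_dominated_convergence[where w = K])
    show "AE x in M. (\<lambda>N. K x - (\<Sum>i\<in>?F N. A i x)) \<longlonglongrightarrow> 0"
    proof (rule AE_I2)
      fix x
      have "(\<lambda>N. \<Sum>i\<in>?F N. A i x) \<longlonglongrightarrow> K x"
        using sum[of x] unfolding has_sum_def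
        by (rule filterlim_compose[OF _ filterlim_to_nat_initial_segments])
      from tendsto_diff[OF tendsto_const this, of "K x"]
      show "(\<lambda>N. K x - (\<Sum>i\<in>?F N. A i x)) \<longlonglongrightarrow> 0" by simp
    qed
    show "AE x in M. norm (K x - (\<Sum>i\<in>?F N. A i x)) \<le> K x" for N
      using bounds[OF fin[of N]] by (auto simp: abs_of_nonneg)
  qed (use K in auto)
  then have lim: "(\<lambda>N. LINT x|M. (K x - (\<Sum>i\<in>?F N. A i x))) \<longlonglongrightarrow> 0" by simp
  \<comment> \<open>The terms are nonnegative, so the remainder shrinks as \<open>F\<close> grows:
    smallness at one initial segment passes to all larger finite sets, and the sequential limit
    extends to the whole net.\<close>
  show ?thesis
  proof (rule tendstoI)
    fix e :: real assume "e > 0"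
    then obtain N where N: "(LINT x|M. (K x - (\<Sum>i\<in>?F N. A i x))) < e"
      using order_tendstoD(2)[OF lim] by (auto simp: eventually_sequentially)
    show "\<forall>\<^sub>F F in finite_subsets_at_top UNIV. dist (LINT x|M. (K x - (\<Sum>i\<in>F. A i x))) 0 < e"
      unfolding eventually_finite_subsets_at_top
    proof (intro exI[of _ "?F N"] conjI allI impI fin)
      fix F assume F: "finite F \<and> ?F N \<subseteq> F \<and> F \<subseteq> UNIV"
      have "(LINT x|M. (K x - (\<Sum>i\<in>F. A i x))) \<le> (LINT x|M. (K x - (\<Sum>i\<in>?F N. A i x)))"
        using F nn fin by (intro integral_mono int) (auto intro!: sum_mono2)
      moreover have "0 \<le> (LINT x|M. (K x - (\<Sum>i\<in>F. A i x)))"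
        using F bounds by (intro Bochner_Integration.integral_nonneg) auto
      ultimately show "dist (LINT x|M. (K x - (\<Sum>i\<in>F. A i x))) 0 < e"
        using N by (simp add: dist_real_def)
    qed simp
  qed
qed

text \<open>The bound on the squared remainder is of product type, so its double integral is the
  square of a single integral, and the square root in \<open>L2_norm\<close> undoes that
  square.\<close>

lemma has_L2_sum_pair_measure:
  fixes f :: "'i :: countable \<Rightarrow> 'a \<times> 'a \<Rightarrow> complex" and A :: "'i \<Rightarrow> 'a \<Rightarrow> real"
  assumes M: "sigma_finite_measure M"
    and f [measurable]: "\<And>i. f i \<in> borel_measurable (M \<Otimes>\<^sub>M M)"
    and f_sum: "\<And>z. ((\<lambda>i. f i z) has_sum g z) UNIV"
    and A [measurable]: "\<And>i. A i \<in> borel_measurable M" and nn: "\<And>i x. 0 \<le> A i x"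
    and A_sum: "\<And>x. ((\<lambda>i. A i x) has_sum K x) UNIV" and K: "integrable M K"
    and le: "\<And>i x y. (cmod (f i (x, y)))\<^sup>2 \<le> A i x * A i y"
  shows "has_L2_sum (M \<Otimes>\<^sub>M M) f g UNIV"
proof -
  interpret sigma_finite_measure M by fact
  interpret pair_sigma_finite M M ..
  define R where "R F x = K x - (\<Sum>i\<in>F. A i x)" for F x
  have A_le: "(\<Sum>i\<in>F. A i x) \<le> K x" if "finite F" for F x
    using finite_sum_le_has_sum[OF A_sum, of F x] that nn by auto
  have K_nn: "0 \<le> K x" for x
    using A_le[of "{}" x] by simp
  have R_nn: "0 \<le> R F x" and R_le: "R F x \<le> K x" if "finite F" for F x
    using A_le[OF that] nn by (auto simp: R_def intro: sum_nonneg)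
  have [measurable]: "K \<in> borel_measurable M" using K by auto
  have [measurable]: "R F \<in> borel_measurable M" for F unfolding R_def by measurable
  have R_int: "integrable M (R F)" if "finite F" for F
    by (rule Bochner_Integration.integrable_bound[OF K]) (use R_nn[OF that] R_le[OF that] K_nn in auto)
  have g [measurable]: "g \<in> borel_measurable (M \<Otimes>\<^sub>M M)"
  proof (rule borel_measurable_LIMSEQ_metric)
    show "(\<lambda>z. \<Sum>i\<in>{i. to_nat i < N}. f i z) \<in> borel_measurable (M \<Otimes>\<^sub>M M)" for N :: nat
      by measurable
    show "(\<lambda>N. \<Sum>i\<in>{i. to_nat i < N}. f i z) \<longlonglongrightarrow> g z" for z
      using f_sum[of z] unfolding has_sum_def
      by (rule filterlim_compose[OF _ filterlim_to_nat_initial_segments])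
  qed
  have rem: "(cmod ((\<Sum>i\<in>F. f i z) - g z))\<^sup>2 \<le> (case z of (x, y) \<Rightarrow> R F x * R F y)" if "finite F" for F z
    using norm_sum_minus_has_sum_square_le[OF f_sum A_sum A_sum le nn nn that] that
    by (cases z) (simp add: R_def)
  have KK: "integrable (M \<Otimes>\<^sub>M M) (\<lambda>(x, y). K x * K y)"
    by (intro integrable_times K)
  have sq: "square_integrable (M \<Otimes>\<^sub>M M) (f i)" for i
    unfolding square_integrable_def
  proof (intro conjI f Bochner_Integration.integrable_bound[OF KK] AE_I2)
    fix z :: "'a \<times> 'a"
    obtain x y where z: "z = (x, y)" by (cases z)
    have "A i x * A i y \<le> K x * K y"
      using A_le[of "{i}"] nn K_nn by (intro mult_mono) auto
    with le[of i x y] show "norm ((cmod (f i z))\<^sup>2) \<le> norm (case z of (x, y) \<Rightarrow> K x * K y)"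
      using K_nn by (simp add: z)
  qed auto
  have sq_rem: "integrable (M \<Otimes>\<^sub>M M) (\<lambda>z. (cmod ((\<Sum>i\<in>F. f i z) - g z))\<^sup>2)" if "finite F" for F
  proof (rule Bochner_Integration.integrable_bound[OF integrable_times[OF R_int[OF that] R_int[OF that]]])
    show "AE z in M \<Otimes>\<^sub>M M. norm ((cmod ((\<Sum>i\<in>F. f i z) - g z))\<^sup>2) \<le> norm (case z of (x, y) \<Rightarrow> R F x * R F y)"
      using rem[OF that] R_nn[OF that] by (auto simp: split: prod.splits)
  qed auto
  \<comment> \<open>The remainder after the empty set is \<open>- g\<close>.\<close>
  have "square_integrable (M \<Otimes>\<^sub>M M) g"
    using sq_rem[of "{}"] g by (simp add: square_integrable_def)
  moreover have "((\<lambda>F. L2_norm (M \<Otimes>\<^sub>M M) (\<lambda>z. (\<Sum>i\<in>F. f i z) - g z)) \<longlongrightarrow> 0) (finite_subsets_at_top UNIV)"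
  proof (rule tendsto_sandwich[OF _ _ tendsto_const])
    show "((\<lambda>F. LINT x|M. R F x) \<longlongrightarrow> 0) (finite_subsets_at_top UNIV)"
      unfolding R_def using A nn A_sum K by (rule has_sum_imp_integral_remainder_tendsto_0)
    show "\<forall>\<^sub>F F in finite_subsets_at_top UNIV. L2_norm (M \<Otimes>\<^sub>M M) (\<lambda>z. (\<Sum>i\<in>F. f i z) - g z) \<le> (LINT x|M. R F x)"
    proof (rule eventually_finite_subsets_at_top_weakI)
      fix F :: "'i set" assume F: "finite F"
      have "(LINT z|(M \<Otimes>\<^sub>M M). (cmod ((\<Sum>i\<in>F. f i z) - g z))\<^sup>2) \<le> (LINT z|(M \<Otimes>\<^sub>M M). (case z of (x, y) \<Rightarrow> R F x * R F y))"
        using rem[OF F] by (intro integral_mono sq_rem[OF F] integrable_times R_int[OF F]) auto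
      also have "\<dots> = (LINT x|M. R F x)\<^sup>2"
        by (simp add: integral_times R_int[OF F] power2_eq_square)
      finally show "L2_norm (M \<Otimes>\<^sub>M M) (\<lambda>z. (\<Sum>i\<in>F. f i z) - g z) \<le> (LINT x|M. R F x)"
        unfolding L2_norm_def using R_nn[OF F] by (intro real_le_lsqrt Bochner_Integration.integral_nonneg) auto
    qed
  qed (auto simp: L2_norm_def intro!: always_eventually Bochner_Integration.integral_nonneg)
  ultimately show ?thesis
    using sq by (simp add: has_L2_sum_def)
qed

section \<open>Majorants for the Mehler series and the final result\<close>

lemma borel_measurable_hermite_laguerre_ito_R2:
  assumes "\<rho> \<noteq> 0"
  shows "hermite_laguerre_ito_R2 \<rho> m n \<in> borel_measurable borel"
proof -
  have "continuous_on UNIV (\<lambda>x. ito_poly (of_real \<rho>) (complex_of_R2 x) (cnj (complex_of_R2 x)) m n)"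
    unfolding ito_poly_def complex_of_R2_def Complex_eq by (intro continuous_intros)
  also have "(\<lambda>x. ito_poly (of_real \<rho>) (complex_of_R2 x) (cnj (complex_of_R2 x)) m n) = hermite_laguerre_ito_R2 \<rho> m n"
    using assms by (simp add: fun_eq_iff hermite_laguerre_ito_R2_eq)
  finally show ?thesis by (rule borel_measurable_continuous_onI)
qed

definition mehler_diag_term :: "real \<Rightarrow> real \<Rightarrow> nat \<Rightarrow> nat \<Rightarrow> real^2 \<Rightarrow> real" where
  "mehler_diag_term \<rho> u m n x =
     u ^ (m + n) / (fact m * fact n * \<rho> ^ (m + n)) * (cmod (hermite_laguerre_ito_R2 \<rho> m n x))\<^sup>2"

lemma mehler_term_diag:
  assumes "\<rho> > 0" "0 < u"
  shows "mehler_term \<rho> 0 u m n x x = of_real (mehler_diag_term \<rho> u m n x)"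
  using mehler_coefficient[OF assms(2), of m n 0]
  by (simp add: mehler_term_def mehler_diag_term_def power_add mult.assoc flip: complex_norm_square)

text \<open>The phases in the coefficient have modulus 1, so the majorants do not depend on
  \<open>c\<close> and the product bound holds with equality.\<close>

lemma norm_mehler_term_square:
  assumes "\<rho> > 0" "0 < u"
  shows "(cmod (mehler_term \<rho> c u m n x y))\<^sup>2 = mehler_diag_term \<rho> u m n x * mehler_diag_term \<rho> u m n y"
  using assms unfolding mehler_term_def mehler_diag_term_def mehler_coefficient[OF assms(2)]
  by (simp add: norm_mult norm_divide norm_power power_mult_distrib power_divide power_add power2_eq_square)

lemma has_sum_mehler_diag_term:
  assumes "\<rho> > 0" "0 < u" "u < 1"
  shows "((\<lambda>(m, n). mehler_diag_term \<rho> u m n x) has_sum mehler_kernel \<rho> 0 1 u x x) UNIV"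
proof -
  have "((\<lambda>z. complex_of_real (case z of (m, n) \<Rightarrow> mehler_diag_term \<rho> u m n x))
          has_sum of_real (mehler_kernel \<rho> 0 1 u x x)) UNIV"
    \<comment> \<open>With \<open>\<Omega> = 0\<close> there is no rotation, and
      \<open>r = 1\<close> is a placeholder.\<close>
    using has_sum_mehler_term[OF assms, of 0 1 x x] assms
    by (simp add: mehler_term_diag case_prod_unfold)
  then show ?thesis by (simp only: has_sum_of_real_iff)
qed

text \<open>A factor \<open>1 - u\<close> cancels in the exponent, leaving the rate
  \<open>2 * u / (\<rho> * (1 + u))\<close>, which is below \<open>1 / \<rho>\<close> because
  \<open>u < 1\<close>.\<close>

lemma integrable_mehler_kernel_diag:
  assumes "\<rho> > 0" "0 < u" "u < 1"
  shows "integrable (gauss_measure \<rho>) (\<lambda>x. mehler_kernel \<rho> 0 1 u x x)"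
proof -
  have u: "u\<^sup>2 < 1" using assms by (simp add: power_less_one_iff)
  have rot: "(rot_Btilde0 0 1 u *v x) \<bullet> x = (norm x)\<^sup>2" for x
    by (simp add: inner_rot_Btilde0 norm_R2_eq flip: complex_norm_square)
  have "- (u\<^sup>2 * (norm x)\<^sup>2 + u\<^sup>2 * (norm x)\<^sup>2 - 2 * u * (norm x)\<^sup>2) / (\<rho> * (1 - u\<^sup>2))
     = 2 * u / (\<rho> * (1 + u)) * (norm x)\<^sup>2" for x :: "real^2"
  proof -
    have "1 - u\<^sup>2 = (1 - u) * (1 + u)" by (simp add: power2_eq_square algebra_simps)
    then have "- (u\<^sup>2 * (norm x)\<^sup>2 + u\<^sup>2 * (norm x)\<^sup>2 - 2 * u * (norm x)\<^sup>2) / (\<rho> * (1 - u\<^sup>2))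
        = (1 - u) * (2 * u * (norm x)\<^sup>2) / ((1 - u) * (\<rho> * (1 + u)))"
      by (simp add: algebra_simps power2_eq_square)
    also have "\<dots> = 2 * u * (norm x)\<^sup>2 / (\<rho> * (1 + u))"
      using assms by (subst mult_divide_mult_cancel_left) auto
    finally show ?thesis by simp
  qed
  then have eq: "(\<lambda>x. mehler_kernel \<rho> 0 1 u x x)
      = (\<lambda>x. 1 / (1 - u\<^sup>2) * exp (2 * u / (\<rho> * (1 + u)) * (norm x)\<^sup>2))"
    unfolding mehler_kernel_def rot by (simp only:)
  have "2 * u / (\<rho> * (1 + u)) < 1 / \<rho>"
    using assms divide_strict_right_mono[of "2 * u / (1 + u)" 1 \<rho>] by (simp add: divide_less_eq mult.commute)
  then show ?thesis
    unfolding eq using assms by (intro integrable_mult_right integrable_gauss_measure_exp)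
qed

text \<open>Unordered summation of complex numbers over pairs is absolute convergence, so the
  pointwise part yields the iterated sum in either order.\<close>

theorem theorem3p1:
  fixes r \<sigma> \<Omega> \<rho> c u :: real
  assumes "r > 0" and "\<sigma>\<^sup>2 > 0"
    and "\<rho> = 2 * \<sigma>\<^sup>2 / r" and "c = \<Omega> / r"
    and "0 < u" and "u < 1"
  shows "(\<forall>x y. ((\<lambda>(m, n). mehler_term \<rho> c u m n x y)
                   has_sum of_real (mehler_kernel \<rho> \<Omega> r u x y)) (UNIV :: (nat \<times> nat) set)) \<and>
         has_L2_sum (gauss_measure \<rho> \<Otimes>\<^sub>M gauss_measure \<rho>)
           (\<lambda>(m, n) (x, y). mehler_term \<rho> c u m n x y)
           (\<lambda>(x, y). of_real (mehler_kernel \<rho> \<Omega> r u x y))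
           (UNIV :: (nat \<times> nat) set)"
proof
  have \<rho>: "\<rho> > 0" using assms by simp
  note pos = \<rho> \<open>0 < u\<close>
  show pointwise: "\<forall>x y. ((\<lambda>(m, n). mehler_term \<rho> c u m n x y)
                   has_sum of_real (mehler_kernel \<rho> \<Omega> r u x y)) UNIV"
    unfolding \<open>c = \<Omega> / r\<close> using has_sum_mehler_term[OF pos \<open>u < 1\<close>] by blast
  have [measurable_cong]: "sets (gauss_measure \<rho>) = sets borel"
    by (simp add: gauss_measure_def)
  have [measurable]: "hermite_laguerre_ito_R2 \<rho> m n \<in> borel_measurable borel" for m n
    using \<rho> by (intro borel_measurable_hermite_laguerre_ito_R2) simp
  have [measurable]: "cnj \<in> borel_measurable borel"
    by (intro borel_measurable_continuous_onI continuous_intros)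
  show "has_L2_sum (gauss_measure \<rho> \<Otimes>\<^sub>M gauss_measure \<rho>)
           (\<lambda>(m, n) (x, y). mehler_term \<rho> c u m n x y)
           (\<lambda>(x, y). of_real (mehler_kernel \<rho> \<Omega> r u x y)) (UNIV :: (nat \<times> nat) set)"
  proof (rule has_L2_sum_pair_measure)
    show "sigma_finite_measure (gauss_measure \<rho>)"
      using \<rho> by (rule sigma_finite_gauss_measure)
    show "(case i of (m, n) \<Rightarrow> \<lambda>(x, y). mehler_term \<rho> c u m n x y)
        \<in> borel_measurable (gauss_measure \<rho> \<Otimes>\<^sub>M gauss_measure \<rho>)" for i
      unfolding case_prod_unfold mehler_term_def by measurable
    show "((\<lambda>i. (case i of (m, n) \<Rightarrow> \<lambda>(x, y). mehler_term \<rho> c u m n x y) z)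
        has_sum (case z of (x, y) \<Rightarrow> of_real (mehler_kernel \<rho> \<Omega> r u x y))) UNIV" for z
      using pointwise by (cases z) (simp add: case_prod_unfold)
    show "(\<lambda>x. case i of (m, n) \<Rightarrow> mehler_diag_term \<rho> u m n x) \<in> borel_measurable (gauss_measure \<rho>)" for i
      unfolding case_prod_unfold mehler_diag_term_def by measurable
    show "0 \<le> (case i of (m, n) \<Rightarrow> mehler_diag_term \<rho> u m n x)" for i x
      using pos by (simp add: mehler_diag_term_def split: prod.split)
    show "((\<lambda>i. case i of (m, n) \<Rightarrow> mehler_diag_term \<rho> u m n x) has_sum mehler_kernel \<rho> 0 1 u x x) UNIV" for x
      using pos \<open>u < 1\<close> by (rule has_sum_mehler_diag_term)
    show "integrable (gauss_measure \<rho>) (\<lambda>x. mehler_kernel \<rho> 0 1 u x x)"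
      using pos \<open>u < 1\<close> by (rule integrable_mehler_kernel_diag)
    show "(cmod ((case i of (m, n) \<Rightarrow> \<lambda>(x, y). mehler_term \<rho> c u m n x y) (x, y)))\<^sup>2
        \<le> (case i of (m, n) \<Rightarrow> mehler_diag_term \<rho> u m n x) * (case i of (m, n) \<Rightarrow> mehler_diag_term \<rho> u m n y)" for i x y
      by (simp add: norm_mehler_term_square[OF pos] split: prod.split)
  qed
qed

end
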